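(* Let $G=(V,P,d)$ be a reversible metric Markov chain with non-negative Ollivier curvature, and let $W\subset V$. Then \[ |\partial W|\ge\frac{P_0}{\operatorname{diam}(\operatorname{cl}(W))}\,m(W)(1-m(W)). \]
   Context: $V$ finite; $P$ with symmetric support; $x\sim y$ iff $x\ne y$, $P(x,y)>0$; $d$ a finite path distance ($d(x,y)=\inf\sum d(x_{k-1},x_k)$ over paths $x=x_0\sim\dots\sim x_n=y$); $m$ the probability with $m(x)P(x,y)=m(y)P(y,x)$. $\Delta f(x)=\sum_yP(x,y)(f(y)-f(x))$; Ollivier curvature $\kappa(x,y)=\inf\{(\Delta f(x)-\Delta f(y))/d(x,y): f\ 1\text{-Lipschitz},\ f(y)-f(x)=d(x,y)\}\ge0$ for all $x\sim y$. $P_0=\inf_{x\sim y}P(x,y)d(x,y)^2$. $|\partial W|=\sum_{x\in W,y\notin W}P(x,y)m(x)d(x,y)$. $\operatorname{cl}(W)=W\cup\{x:x\sim y\text{ for some }y\in W\}$, and $\operatorname{diam}(S)=\max_{x,y\in S}d(x,y)$ measured in the distance $d$ of $G$. *)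

theory Defs
  imports Complex_Main
begin

definition adj :: "('a \<Rightarrow> 'a \<Rightarrow> real) \<Rightarrow> 'a \<Rightarrow> 'a \<Rightarrow> bool" where
  "adj P x y \<longleftrightarrow> x \<noteq> y \<and> P x y > 0"

definition is_walk :: "('a \<Rightarrow> 'a \<Rightarrow> real) \<Rightarrow> 'a \<Rightarrow> 'a \<Rightarrow> 'a list \<Rightarrow> bool" where
  "is_walk P x y xs \<longleftrightarrow> xs \<noteq> [] \<and> hd xs = x \<and> last xs = y \<and>
     (\<forall>i. Suc i < length xs \<longrightarrow> adj P (xs ! i) (xs ! Suc i))"

definition walk_length :: "('a \<Rightarrow> 'a \<Rightarrow> real) \<Rightarrow> 'a list \<Rightarrow> real" where
  "walk_length d xs = (\<Sum>i<length xs - 1. d (xs ! i) (xs ! Suc i))"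

definition reversible_metric_markov_chain ::
  "('a::finite \<Rightarrow> 'a \<Rightarrow> real) \<Rightarrow> ('a \<Rightarrow> 'a \<Rightarrow> real) \<Rightarrow> ('a \<Rightarrow> real) \<Rightarrow> bool" where
  "reversible_metric_markov_chain P d m \<longleftrightarrow>
     (\<forall>x y. P x y \<ge> 0) \<and> (\<forall>x. (\<Sum>y\<in>UNIV. P x y) = 1) \<and>
     (\<forall>x y. P x y > 0 \<longleftrightarrow> P y x > 0) \<and>
     (\<forall>x y. adj P x y \<longrightarrow> d x y > 0) \<and>
     (\<forall>x y. d x y = d y x) \<and>
     (\<forall>x y. {xs. is_walk P x y xs} \<noteq> {}) \<and>
     (\<forall>x y. d x y = Inf (walk_length d ` {xs. is_walk P x y xs})) \<and>
     (\<forall>x. m x \<ge> 0) \<and> (\<Sum>x\<in>UNIV. m x) = 1 \<and>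
     (\<forall>x y. m x * P x y = m y * P y x)"

definition laplacian :: "('a::finite \<Rightarrow> 'a \<Rightarrow> real) \<Rightarrow> ('a \<Rightarrow> real) \<Rightarrow> 'a \<Rightarrow> real" where
  "laplacian P f x = (\<Sum>y\<in>UNIV. P x y * (f y - f x))"

definition lipschitz1 :: "('a \<Rightarrow> 'a \<Rightarrow> real) \<Rightarrow> ('a \<Rightarrow> real) \<Rightarrow> bool" where
  "lipschitz1 d f \<longleftrightarrow> (\<forall>u v. \<bar>f u - f v\<bar> \<le> d u v)"

definition ollivier_curvature ::
  "('a::finite \<Rightarrow> 'a \<Rightarrow> real) \<Rightarrow> ('a \<Rightarrow> 'a \<Rightarrow> real) \<Rightarrow> 'a \<Rightarrow> 'a \<Rightarrow> real" where
  "ollivier_curvature P d x y =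
     Inf {(laplacian P f x - laplacian P f y) / d x y | f. lipschitz1 d f \<and> f y - f x = d x y}"

definition P0 :: "('a \<Rightarrow> 'a \<Rightarrow> real) \<Rightarrow> ('a \<Rightarrow> 'a \<Rightarrow> real) \<Rightarrow> real" where
  "P0 P d = Inf ((\<lambda>(x, y). P x y * (d x y)\<^sup>2) ` {(x, y). adj P x y})"

definition boundary_measure ::
  "('a::finite \<Rightarrow> 'a \<Rightarrow> real) \<Rightarrow> ('a \<Rightarrow> 'a \<Rightarrow> real) \<Rightarrow> ('a \<Rightarrow> real) \<Rightarrow> 'a set \<Rightarrow> real" where
  "boundary_measure P d m W = (\<Sum>x\<in>W. \<Sum>y\<in>- W. P x y * m x * d x y)"

definition closure_set :: "('a \<Rightarrow> 'a \<Rightarrow> real) \<Rightarrow> 'a set \<Rightarrow> 'a set" where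
  "closure_set P W = W \<union> {x. \<exists>y\<in>W. adj P x y}"

definition diameter :: "('a \<Rightarrow> 'a \<Rightarrow> real) \<Rightarrow> 'a set \<Rightarrow> real" where
  "diameter d S = (if S = {} then 0 else Max {d x y | x y. x \<in> S \<and> y \<in> S})"

end

(* Let K be the complement of W. By Brouwer's theorem there is a 1-Lipschitz f with constant
   Laplacian C on K such that each vertex of W lies below some vertex of K along a geodesic on which
   f has slope 1; non-negative curvature then gives Laplacian at least C on W. Summing the squared
   upward differences of f over W gives at least P_0 m(W), while integration by parts bounds the same
   sum by boundary terms of size diam(cl W) |bd W| and a bulk term controlled by C, and
   -C (1 - m(W)) is at most |bd W| because the Laplacian has mean zero. *)
theory Submission
  imports "HOL-Analysis.Analysis" Defs
begin

section \<open>Walks and the path metric\<close>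

locale metric_chain =
  fixes P d :: "'a::finite \<Rightarrow> 'a \<Rightarrow> real" and m :: "'a \<Rightarrow> real"
  assumes chain: "reversible_metric_markov_chain P d m"
begin

lemma P_nonneg: "P x y \<ge> 0"
  and P_pos_sym: "P x y > 0 \<longleftrightarrow> P y x > 0"
  and d_adj_pos: "adj P x y \<Longrightarrow> d x y > 0"
  and d_sym: "d x y = d y x"
  and walk_ex: "\<exists>xs. is_walk P x y xs"
  and d_Inf: "d x y = Inf (walk_length d ` {xs. is_walk P x y xs})"
  and m_nonneg: "m x \<ge> 0"
  and m_sum: "sum m UNIV = 1"
  and reversible: "m x * P x y = m y * P y x"
  using chain unfolding reversible_metric_markov_chain_def by auto

lemma is_walk_single: "is_walk P x y [a] \<longleftrightarrow> a = x \<and> a = y"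
  by (auto simp: is_walk_def)

lemma is_walk_Cons: "is_walk P x y (a # b # w) \<longleftrightarrow> a = x \<and> adj P a b \<and> is_walk P b y (b # w)"
  by (auto simp: is_walk_def All_less_Suc2)

lemma walk_length_single: "walk_length d [a] = 0"
  by (simp add: walk_length_def)

lemma walk_length_Cons: "walk_length d (a # b # w) = d a b + walk_length d (b # w)"
  by (simp add: walk_length_def sum.lessThan_Suc_shift del: sum.lessThan_Suc)

lemma walk_length_nonneg: "is_walk P x y xs \<Longrightarrow> walk_length d xs \<ge> 0"
proof (induction xs arbitrary: x rule: induct_list012)
  case (3 a b w)
  then have "adj P a b" "is_walk P b y (b # w)" by (auto simp: is_walk_Cons)
  with d_adj_pos[of a b] "3.IH"(2)[of b] show ?case by (simp add: walk_length_Cons)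
qed (auto simp: walk_length_single is_walk_def)

lemma d_le_walk: "is_walk P x y xs \<Longrightarrow> d x y \<le> walk_length d xs"
  by (subst d_Inf, rule cInf_lower) (auto intro!: bdd_belowI[of _ 0] walk_length_nonneg)

lemma le_d_walk: "(\<And>xs. is_walk P x y xs \<Longrightarrow> c \<le> walk_length d xs) \<Longrightarrow> c \<le> d x y"
  using walk_ex[of x y] by (subst d_Inf, intro cInf_greatest) auto

lemma d_nonneg: "d x y \<ge> 0"
  by (rule le_d_walk) (rule walk_length_nonneg)

lemma d_refl: "d x x = 0"
  using d_le_walk[of x x "[x]"] d_nonneg[of x x] by (simp add: is_walk_single walk_length_single)

lemma d_step:
  assumes "adj P x y" shows "d x z \<le> d x y + d y z"
proof -
  have "d x z - d x y \<le> d y z"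
  proof (rule le_d_walk)
    fix xs assume w: "is_walk P y z xs"
    then obtain ys where xs: "xs = y # ys" by (cases xs) (auto simp: is_walk_def)
    then show "d x z - d x y \<le> walk_length d xs"
      using d_le_walk[of x z "x # y # ys"] w assms by (simp add: is_walk_Cons walk_length_Cons)
  qed
  then show ?thesis by simp
qed

text \<open>Induction along a walk from \<open>x\<close> to \<open>y\<close>, peeling off one edge
  at a time by \<open>d_step\<close>, replaces concatenation of walks.\<close>

lemma d_triangle: "d x z \<le> d x y + d y z"
proof -
  have "is_walk P x y xs \<Longrightarrow> d x z - d y z \<le> walk_length d xs" for xs
  proof (induction xs arbitrary: x rule: induct_list012)
    case (3 a b w)
    then have "d b z - d y z \<le> walk_length d (b # w)" "a = x" "adj P x b"
      by (auto simp: is_walk_Cons)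
    then show ?case using d_step[of x b z] by (simp add: walk_length_Cons)
  qed (auto simp: walk_length_single is_walk_def)
  from le_d_walk[OF this] show ?thesis by force
qed

text \<open>Every walk from \<open>x\<close> to \<open>z\<close> is at least as long as
  \<open>d x y + d y z\<close> for its second vertex \<open>y\<close>, and this expression has a
  minimum over the finitely many neighbours. Iterating it follows a geodesic without any need for a
  walk that attains the infimum.\<close>

lemma first_step:
  assumes "x \<noteq> z"
  obtains y where "adj P x y" "d x z = d x y + d y z"
proof -
  let ?A = "{y. adj P x y}"
  have step: "\<exists>y\<in>?A. d x y + d y z \<le> walk_length d xs" if w: "is_walk P x z xs" for xs
  proof -
    from w assms obtain a b ws where "xs = a # b # ws"
      by (cases xs rule: remdups_adj.cases) (auto simp: is_walk_def)
    with w show ?thesis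
      using d_le_walk[of b z "b # ws"] by (auto simp: is_walk_Cons walk_length_Cons)
  qed
  have ne: "?A \<noteq> {}" using walk_ex[of x z] step by blast
  obtain y where y: "y \<in> ?A" "\<And>y'. y' \<in> ?A \<Longrightarrow> d x y + d y z \<le> d x y' + d y' z"
    using arg_min_if_finite[of ?A "\<lambda>y. d x y + d y z"] ne by (meson finite not_le)
  have "d x y + d y z \<le> d x z"
  proof (rule le_d_walk)
    fix xs assume "is_walk P x z xs"
    then obtain y' where "y' \<in> ?A" "d x y' + d y' z \<le> walk_length d xs" using step by blast
    then show "d x y + d y z \<le> walk_length d xs" using y(2)[of y'] by linarith
  qed
  then show ?thesis using that[of y] y(1) d_triangle[of x z y] by force
qed

section \<open>Edge weights and Lipschitz functions\<close>

lemma P0_le: "adj P x y \<Longrightarrow> P0 P d \<le> P x y * (d x y)\<^sup>2"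
  unfolding P0_def
  by (rule cInf_lower) (auto intro!: bdd_belowI[of _ 0] mult_nonneg_nonneg P_nonneg)

lemma lipschitz1D:
  assumes "lipschitz1 d f" shows "f y - f x \<le> d x y"
proof -
  have "\<bar>f y - f x\<bar> \<le> d y x" using assms by (simp add: lipschitz1_def)
  then show ?thesis using d_sym[of x y] by linarith
qed

lemma laplacian_bound:
  assumes "lipschitz1 d f" shows "\<bar>laplacian P f x\<bar> \<le> (\<Sum>y\<in>UNIV. P x y * d x y)"
  unfolding laplacian_def
proof (rule order_trans[OF sum_abs], rule sum_mono)
  fix y show "\<bar>P x y * (f y - f x)\<bar> \<le> P x y * d x y"
    using assms P_nonneg[of x y] d_sym[of x y]
    by (auto simp: abs_mult lipschitz1_def intro!: mult_left_mono)
qed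

end

section \<open>Monotonicity of the Laplacian along geodesics\<close>

locale nonneg_curved_chain = metric_chain +
  assumes curv: "adj P x y \<Longrightarrow> ollivier_curvature P d x y \<ge> 0"
begin

text \<open>\<open>f\<close> itself competes in the infimum that defines the curvature, so its
  quotient is at least the curvature and hence non-negative.\<close>

lemma laplacian_antimono_edge:
  assumes f: "lipschitz1 d f" and adj: "adj P x y" and eq: "f y - f x = d x y"
  shows "laplacian P f y \<le> laplacian P f x"
proof -
  let ?S = "{(laplacian P f x - laplacian P f y) / d x y | f. lipschitz1 d f \<and> f y - f x = d x y}"
  let ?B = "\<lambda>x. \<Sum>y\<in>UNIV. P x y * d x y"
  have d: "d x y > 0" using adj by (rule d_adj_pos)
  \<comment> \<open>On the reals \<open>Inf\<close> is known to be a lower bound only of a set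
    bounded below; the uniform bound on Laplacians of 1-Lipschitz functions provides this.\<close>
  have "bdd_below ?S"
  proof (rule bdd_belowI)
    fix r assume "r \<in> ?S"
    then obtain g where g: "lipschitz1 d g" "r = (laplacian P g x - laplacian P g y) / d x y" by blast
    have "- (?B x + ?B y) \<le> laplacian P g x - laplacian P g y"
      using laplacian_bound[OF g(1), of x] laplacian_bound[OF g(1), of y] by linarith
    then show "- (?B x + ?B y) / d x y \<le> r"
      unfolding g(2) by (rule divide_right_mono) (rule d_nonneg)
  qed
  then have "Inf ?S \<le> (laplacian P f x - laplacian P f y) / d x y"
    by (rule cInf_lower[rotated]) (intro CollectI exI[of _ f] conjI refl f eq)
  with curv[OF adj] have "0 \<le> (laplacian P f x - laplacian P f y) / d x y"
    unfolding ollivier_curvature_def by (rule order_trans)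
  with d have "0 \<le> laplacian P f x - laplacian P f y"
    by (metis divide_neg_pos not_le)
  then show ?thesis by simp
qed

text \<open>A 1-Lipschitz \<open>f\<close> that gains the full distance from \<open>x\<close> to
  \<open>z\<close> has slope 1 on every edge of a geodesic between them, so the edge case can be
  chained.\<close>

lemma laplacian_antimono:
  assumes f: "lipschitz1 d f" and eq: "f z - f x = d x z"
  shows "laplacian P f z \<le> laplacian P f x"
  using eq
\<comment> \<open>Real distances are not well-founded, so the induction counts the vertices strictly
  nearer to \<open>z\<close> than \<open>x\<close>; moving to \<open>y\<close> removes at least
  \<open>y\<close> from the count.\<close>
proof (induction "card {w. d w z < d x z}" arbitrary: x rule: less_induct)
  case less
  show ?case
  proof (cases "x = z")
    case False
    then obtain y where y: "adj P x y" "d x z = d x y + d y z" by (rule first_step)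
    have "f y - f x \<le> d x y" "f z - f y \<le> d y z"
      using f by (rule lipschitz1D)+
    with y less.prems have eqs: "f y - f x = d x y" "f z - f y = d y z" by linarith+
    have "d y z < d x z" using y(2) d_adj_pos[OF y(1)] by linarith
    then have "{w. d w z < d y z} \<subseteq> {w. d w z < d x z}" "y \<in> {w. d w z < d x z} - {w. d w z < d y z}"
      by auto
    then have "{w. d w z < d y z} \<subset> {w. d w z < d x z}" by blast
    then have "laplacian P f z \<le> laplacian P f y" by (intro less.hyps psubset_card_mono eqs(2) finite)
    then show ?thesis using laplacian_antimono_edge[OF f y(1) eqs(1)] by linarith
  qed simp
qed

section \<open>The smallest Lipschitz extension from K\<close>

text \<open>McShane's lower extension. The smallest extension is taken because its value at
  \<open>x\<close> is attained at some \<open>z\<close> in \<open>K\<close>, above \<open>x\<close>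
  by exactly the distance.\<close>

definition extend :: "'a set \<Rightarrow> ('a \<Rightarrow> real) \<Rightarrow> 'a \<Rightarrow> real" where
  "extend K f x = Max ((\<lambda>z. f z - d z x) ` K)"

lemma extend_ge: "z \<in> K \<Longrightarrow> f z - d z x \<le> extend K f x"
  unfolding extend_def by (rule Max_ge) auto

lemma extend_attained:
  assumes "K \<noteq> {}" obtains z where "z \<in> K" "extend K f x = f z - d z x"
proof -
  have "extend K f x \<in> (\<lambda>z. f z - d z x) ` K"
    unfolding extend_def using assms by (intro Max_in) auto
  then show ?thesis using that by auto
qed

lemma lipschitz1_extend:
  assumes "K \<noteq> {}" shows "lipschitz1 d (extend K f)"
proof -
  have *: "extend K f u - extend K f v \<le> d u v" for u v
  proof -
    obtain z where "z \<in> K" "extend K f u = f z - d z u" using assms by (rule extend_attained)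
    then show ?thesis using extend_ge[of z K f v] d_triangle[of z v u] by linarith
  qed
  have "\<bar>extend K f u - extend K f v\<bar> \<le> d u v" for u v
    using *[of u v] *[of v u] d_sym[of u v] by linarith
  then show ?thesis by (simp add: lipschitz1_def)
qed

lemma extend_eq:
  assumes "x \<in> K" "\<And>z. z \<in> K \<Longrightarrow> f z - f x \<le> d z x"
  shows "extend K f x = f x"
proof -
  obtain z where "z \<in> K" "extend K f x = f z - d z x" using assms(1) extend_attained by blast
  then show ?thesis using extend_ge[of x K f x] assms d_refl[of x] by force
qed

text \<open>Continuity in the prescribed values, with \<open>x\<close> fixed, is needed for
  Brouwer's theorem. Induction on \<open>K\<close> reduces the finite maximum to binary
  ones.\<close>

lemma continuous_extend: "K \<noteq> {} \<Longrightarrow> continuous_on A (\<lambda>f. extend K (vec_nth f) x)"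
  unfolding extend_def
proof (induction K rule: infinite_finite_induct)
  case (insert z F)
  show ?case
  proof (cases "F = {}")
    case False
    then have "(\<lambda>f::real^'a. Max ((\<lambda>z. f $ z - d z x) ` insert z F)) =
        (\<lambda>f. max (f $ z - d z x) (Max ((\<lambda>z. f $ z - d z x) ` F)))"
      by simp
    with insert.IH[OF False] show ?thesis
      by (simp only:) (intro continuous_intros)
  qed (auto intro!: continuous_intros)
qed auto

section \<open>Constant Laplacian on K by Brouwer's theorem\<close>

lemma laplacian_separation:
  assumes "K \<noteq> {}"
  obtains f C where "lipschitz1 d f" "\<And>x. x \<in> K \<Longrightarrow> laplacian P f x = C"
    "\<And>x. \<exists>z\<in>K. f z - f x = d x z"
proof -
  obtain k where k: "k \<in> K" using assms by blast
  \<comment> \<open>\<open>L\<close> encodes the 1-Lipschitz functions on \<open>K\<close>. Adding a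
    constant changes no Laplacian, so \<open>f $ k = 0\<close> may be imposed; this and the value 0
    off \<open>K\<close> make \<open>L\<close> compact.\<close>
  define L :: "(real^'a) set" where
    "L = {f. (\<forall>x y. x \<in> K \<and> y \<in> K \<longrightarrow> f $ x - f $ y \<le> d x y) \<and> (\<forall>x. x \<notin> K \<longrightarrow> f $ x = 0) \<and> f $ k = 0}"
  define \<Delta> where "\<Delta> f = laplacian P (extend K (vec_nth f))" for f :: "real^'a"
  \<comment> \<open>Subtracting \<open>\<Delta> f k\<close> keeps the field tangent to the
    normalisation at \<open>k\<close>. A zero of \<open>u\<close> is a function whose extension has
    constant Laplacian on \<open>K\<close>.\<close>
  define u :: "real^'a \<Rightarrow> real^'a" where
    "u f = (\<chi> x. if x \<in> K then \<Delta> f x - \<Delta> f k else 0)" for f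
  have closed: "closed L"
    unfolding L_def
    by (intro closed_Collect_conj closed_Collect_all closed_Collect_imp closed_Collect_le
        closed_Collect_eq continuous_intros open_Collect_const)
  have convex: "convex L"
  proof (rule convexI)
    fix f g :: "real^'a" and a b :: real
    assume fg: "f \<in> L" "g \<in> L" and ab: "0 \<le> a" "0 \<le> b" "a + b = 1"
    have "(a *\<^sub>R f + b *\<^sub>R g) $ x - (a *\<^sub>R f + b *\<^sub>R g) $ y \<le> d x y" if "x \<in> K" "y \<in> K" for x y
    proof -
      have "a * (f $ x - f $ y) + b * (g $ x - g $ y) \<le> d x y"
        using fg ab that by (intro convex_bound_le) (auto simp: L_def)
      then show ?thesis by (simp add: algebra_simps)
    qed
    then show "a *\<^sub>R f + b *\<^sub>R g \<in> L" using fg by (simp add: L_def)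
  qed
  have "bounded L"
  proof (rule boundedI)
    fix f assume f: "f \<in> L"
    have "\<bar>f $ x\<bar> \<le> d x k" for x
    proof (cases "x \<in> K")
      case True
      then have "f $ x - f $ k \<le> d x k" "f $ k - f $ x \<le> d k x" "f $ k = 0"
        using f k unfolding L_def by blast+
      then show ?thesis using d_sym[of x k] by linarith
    next
      case False
      then show ?thesis using f d_nonneg by (auto simp: L_def)
    qed
    then show "norm f \<le> (\<Sum>x\<in>UNIV. d x k)"
      using norm_le_l1_cart[of f] by (meson order_trans sum_mono)
  qed
  with closed have compact: "compact L" by (simp add: compact_eq_bounded_closed)
  have ne: "L \<noteq> {}" using d_nonneg by (auto simp: L_def intro!: exI[of _ 0])
  have cont: "continuous_on A u" for A
    unfolding u_def \<Delta>_def laplacian_def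
    by (intro continuous_on_vec_lambda, rename_tac x, case_tac "x \<in> K")
      (auto intro!: continuous_intros continuous_extend assms)
  \<comment> \<open>At a fixed point, \<open>f\<close> is the projection of \<open>f + u f\<close>
    onto \<open>L\<close>, so \<open>u f\<close> is an outer normal of \<open>L\<close> at
    \<open>f\<close>.\<close>
  obtain f where f: "f \<in> L" "closest_point L (f + u f) = f"
  proof (rule brouwer[OF compact convex ne])
    show "continuous_on L (\<lambda>f. closest_point L (f + u f))"
      by (rule continuous_on_compose2[OF continuous_on_closest_point[OF convex closed ne, of UNIV]])
        (auto intro!: continuous_intros cont)
    show "(\<lambda>f. closest_point L (f + u f)) \<in> L \<rightarrow> L"
      using closest_point_in_set[OF closed ne] by auto
  qed
  have fK: "f $ x - f $ y \<le> d x y" if "x \<in> K" "y \<in> K" for x y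
    using f(1) that by (auto simp: L_def)
  have ext: "extend K (vec_nth f) x = f $ x" if "x \<in> K" for x
    using that fK by (intro extend_eq) auto
  \<comment> \<open>The vector field u points into the polytope L: where a constraint of L is tight,
    non-negative curvature gives u the right sign.\<close>
  have "\<forall>\<^sub>F t in at_right 0. f $ x - f $ y + t * (u f $ x - u f $ y) \<le> d x y"
    if "x \<in> K" "y \<in> K" for x y
  proof (cases "f $ x - f $ y = d x y")
    case True
    then have "\<Delta> f x \<le> \<Delta> f y"
      unfolding \<Delta>_def using ext that d_sym[of x y]
      by (intro laplacian_antimono lipschitz1_extend assms) auto
    then have "u f $ x - u f $ y \<le> 0" using that by (simp add: u_def)
    then have "t * (u f $ x - u f $ y) \<le> 0" if "t > 0" for t
      using that by (simp add: mult_nonneg_nonpos)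
    then show ?thesis
      using True by (intro eventually_at_rightI[of 0 1]) (auto simp: le_diff_eq)
  next
    case False
    then have *: "f $ x - f $ y + 0 * (u f $ x - u f $ y) < d x y" using fK[OF that] by simp
    have "((\<lambda>t. f $ x - f $ y + t * (u f $ x - u f $ y)) \<longlongrightarrow>
        f $ x - f $ y + 0 * (u f $ x - u f $ y)) (at_right 0)"
      by (intro tendsto_intros)
    from order_tendstoD(2)[OF this *] show ?thesis by (rule eventually_mono) simp
  qed
  \<comment> \<open>There are finitely many constraints, so one small \<open>t > 0\<close> serves
    them all.\<close>
  then have "\<forall>\<^sub>F t in at_right (0::real). \<forall>x\<in>K. \<forall>y\<in>K. f $ x - f $ y + t * (u f $ x - u f $ y) \<le> d x y"
    by (auto intro!: eventually_ball_finite)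
  then have "\<forall>\<^sub>F t in at_right (0::real). t > 0 \<and> (\<forall>x\<in>K. \<forall>y\<in>K. f $ x - f $ y + t * (u f $ x - u f $ y) \<le> d x y)"
    using eventually_at_right_less[of "0::real"] by (rule eventually_conj[rotated])
  then obtain t :: real where t: "t > 0"
    "\<And>x y. x \<in> K \<Longrightarrow> y \<in> K \<Longrightarrow> f $ x - f $ y + t * (u f $ x - u f $ y) \<le> d x y"
    using eventually_happens'[OF trivial_limit_at_right_real] by blast
  have "f + t *\<^sub>R u f \<in> L"
    using f(1) t(2) k by (auto simp: L_def u_def algebra_simps)
  \<comment> \<open>The outer normal \<open>u f\<close> makes no acute angle with the feasible
    displacement \<open>t *\<^sub>R u f\<close>, which forces \<open>u f = 0\<close>.\<close>
  from closest_point_dot[OF convex closed this, of "f + u f"]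
  have "t * (u f \<bullet> u f) \<le> 0" by (simp add: f(2))
  then have "u f \<bullet> u f \<le> 0" using t(1) by (simp add: mult_le_0_iff del: inner_eq_zero_iff)
  then have "u f = 0" by (metis inner_eq_zero_iff inner_ge_zero order_antisym)
  then have "\<Delta> f x = \<Delta> f k" if "x \<in> K" for x
    using that by (auto simp: u_def vec_eq_iff split: if_splits)
  moreover have "\<exists>z\<in>K. extend K (vec_nth f) z - extend K (vec_nth f) x = d x z" for x
  proof -
    obtain z where z: "z \<in> K" "extend K (vec_nth f) x = f $ z - d z x"
      using extend_attained[OF assms] by blast
    then have "extend K (vec_nth f) z - extend K (vec_nth f) x = d x z"
      using ext[OF z(1)] d_sym[of x z] by simp
    with z(1) show ?thesis by blast
  qed
  ultimately show ?thesis
    using that[of "extend K (vec_nth f)" "\<Delta> f k"] lipschitz1_extend[OF assms]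
    unfolding \<Delta>_def by blast
qed

section \<open>Integration by parts and the isoperimetric inequality\<close>

lemma d_le_diameter:
  assumes "x \<in> S" "y \<in> S" shows "d x y \<le> diameter d S"
proof -
  have "{d x y | x y. x \<in> S \<and> y \<in> S} = (\<lambda>(x, y). d x y) ` (S \<times> S)" by auto
  then have "d x y \<le> Max {d x y | x y. x \<in> S \<and> y \<in> S}"
    using assms by (intro Max_ge) auto
  then show ?thesis using assms by (auto simp: diameter_def)
qed

text \<open>Discrete divergence theorem: the flows inside \<open>W\<close> cancel in pairs and only
  those leaving \<open>W\<close> remain. For \<open>W = UNIV\<close> the total is zero.\<close>

lemma sum_antisym:
  fixes h :: "'a \<Rightarrow> 'a \<Rightarrow> real"
  assumes "\<And>x y. h x y + h y x = 0"
  shows "(\<Sum>x\<in>W. \<Sum>y\<in>UNIV. h x y) = (\<Sum>x\<in>W. \<Sum>y\<in>-W. h x y)"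
proof -
  have "2 * (\<Sum>x\<in>W. \<Sum>y\<in>W. h x y) = (\<Sum>x\<in>W. \<Sum>y\<in>W. h x y) + (\<Sum>x\<in>W. \<Sum>y\<in>W. h y x)"
    by (subst (3) sum.swap) simp
  also have "\<dots> = 0" by (simp add: assms flip: sum.distrib)
  finally have "(\<Sum>x\<in>W. \<Sum>y\<in>W. h x y) = 0" by simp
  moreover have "(\<Sum>y\<in>UNIV. h x y) = (\<Sum>y\<in>W. h x y) + (\<Sum>y\<in>-W. h x y)" for x
    using sum.union_disjoint[of W "- W" "h x"] by simp
  ultimately show ?thesis by (simp add: sum.distrib)
qed

lemma boundary_measure_nonneg: "boundary_measure P d m W \<ge> 0"
  unfolding boundary_measure_def by (intro sum_nonneg mult_nonneg_nonneg P_nonneg m_nonneg d_nonneg)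

lemma isoperimetry:
  fixes W :: "'a set"
  defines "D \<equiv> diameter d (closure_set P W)" and "M \<equiv> sum m W" and "B \<equiv> boundary_measure P d m W"
  shows "P0 P d / D * (M * (1 - M)) \<le> B"
\<comment> \<open>In each of these cases the left side is 0, for \<open>D = 0\<close> because
  division by zero gives 0. Otherwise \<open>W\<close> and its complement are non-empty and
  \<open>1 - M\<close> can be divided by.\<close>
proof (cases "D = 0 \<or> M = 0 \<or> M = 1")
  case True
  then show ?thesis using boundary_measure_nonneg by (auto simp: B_def)
next
  case False
  have M: "0 \<le> M" "M \<le> 1" and MC: "sum m (-W) = 1 - M"
    using sum_nonneg[of W m] sum_nonneg[of "-W" m] m_nonneg m_sum
      sum.union_disjoint[of W "-W" m] by (auto simp: M_def)
  with False have M1: "M < 1" by simp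
  from False MC have ne: "W \<noteq> {}" "- W \<noteq> {}" by (auto simp: M_def)
  let ?cl = "closure_set P W"
  have W_cl: "x \<in> ?cl" if "x \<in> W" for x using that by (auto simp: closure_set_def)
  have nbr_cl: "y \<in> ?cl" if "x \<in> W" "y \<notin> W" "P x y > 0" for x y
    using that P_pos_sym[of x y] by (auto simp: closure_set_def adj_def)
  from ne W_cl have cl_ne: "?cl \<noteq> {}" by auto
  then have D0: "D \<ge> 0" unfolding D_def using d_le_diameter d_nonneg order_trans by (meson ex_in_conv)
  with False have D: "D > 0" by simp
  obtain f C where f: "lipschitz1 d f" "\<And>x. x \<in> -W \<Longrightarrow> laplacian P f x = C"
    "\<And>x. \<exists>z\<in>-W. f z - f x = d x z"
    using laplacian_separation[OF ne(2)] by blast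
  \<comment> \<open>The shift puts the values on \<open>?cl\<close> between 0 and \<open>D\<close>
    and leaves the Laplacian unchanged.\<close>
  define g where "g x = f x - Min (f ` ?cl)" for x
  have g0: "0 \<le> g x" if "x \<in> ?cl" for x
    using that by (auto simp: g_def intro!: Min_le)
  have gD: "g x \<le> D" if "x \<in> ?cl" for x
  proof -
    have "Min (f ` ?cl) \<in> f ` ?cl" using cl_ne by (intro Min_in) auto
    then obtain y where "y \<in> ?cl" "Min (f ` ?cl) = f y" by auto
    then show ?thesis
      using lipschitz1D[OF f(1), of x y] d_le_diameter[of y ?cl x] that d_sym[of x y]
      by (simp add: g_def D_def)
  qed
  have g_lip: "g y - g x \<le> d x y" for x y using lipschitz1D[OF f(1)] by (simp add: g_def)
  have g_lap: "laplacian P g = laplacian P f" by (simp add: laplacian_def g_def fun_eq_iff)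
  have lap_W: "C \<le> laplacian P g x" for x
  proof -
    from f(3) obtain z where "z \<in> -W" "f z - f x = d x z" by blast
    then show ?thesis using laplacian_antimono[OF f(1)] f(2) g_lap by force
  qed
  have up: "\<exists>y. adj P x y \<and> g y - g x = d x y" if "x \<in> W" for x
  proof -
    from f(3) obtain z where z: "z \<in> -W" "f z - f x = d x z" by blast
    with that have "x \<noteq> z" by auto
    then obtain y where y: "adj P x y" "d x z = d x y + d y z" by (rule first_step)
    have "f y - f x \<le> d x y" "f z - f y \<le> d y z" using f(1) by (rule lipschitz1D)+
    with y z have "f y - f x = d x y" by linarith
    with y show ?thesis by (auto simp: g_def)
  qed
  define p where "p x y = m x * P x y" for x y
  have p_sym: "p x y = p y x" for x y by (simp add: p_def reversible)
  have p_nonneg: "p x y \<ge> 0" for x y by (simp add: p_def m_nonneg P_nonneg)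
  have B: "B = (\<Sum>x\<in>W. \<Sum>y\<in>-W. p x y * d x y)"
    unfolding B_def boundary_measure_def p_def by (simp add: mult.commute)
  have lap: "m x * laplacian P g x = (\<Sum>y\<in>UNIV. p x y * (g y - g x))" for x
    by (simp add: laplacian_def p_def sum_distrib_left mult.assoc)
  have flux_antisym: "p x y * (g y - g x) + p y x * (g x - g y) = 0" for x y
    using p_sym[of x y] by (simp add: algebra_simps)

  \<comment> \<open>The flux of the gradient of \<open>g\<close> out of \<open>W\<close> is at most
    \<open>B\<close> by the Lipschitz bound. Since the Laplacian has mean zero, the part on the
    complement, \<open>(1 - M) * C\<close>, is at least \<open>- B\<close>.\<close>
  have "(\<Sum>x\<in>W. m x * laplacian P g x) \<le> B"
    unfolding lap B sum_antisym[of "\<lambda>x y. p x y * (g y - g x)", OF flux_antisym]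
    by (intro sum_mono mult_left_mono g_lip p_nonneg)
  moreover have "(\<Sum>x\<in>UNIV. m x * laplacian P g x) = 0"
    unfolding lap sum_antisym[of "\<lambda>x y. p x y * (g y - g x)", OF flux_antisym] by simp
  moreover have "(\<Sum>x\<in>-W. m x * laplacian P g x) = (1 - M) * C"
    using f(2) by (simp add: g_lap MC flip: sum_distrib_right)
  ultimately have C: "- C * (1 - M) \<le> B"
    using sum.union_disjoint[of W "-W" "\<lambda>x. m x * laplacian P g x"] by (simp add: algebra_simps)

  \<comment> \<open>Only upward differences are counted, so that each edge inside W enters once;
    with squares of all differences a factor 2 would be lost.\<close>
  define S where "S = (\<Sum>x\<in>W. \<Sum>y\<in>UNIV. p x y * (max 0 (g y - g x))\<^sup>2)"
  \<comment> \<open>The single slope-1 edge leaving \<open>x\<close> upwards already contributes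
    this much.\<close>
  have "P0 P d * m x \<le> (\<Sum>y\<in>UNIV. p x y * (max 0 (g y - g x))\<^sup>2)" if x: "x \<in> W" for x
  proof -
    from up[OF x] obtain y where y: "adj P x y" "g y - g x = d x y" by blast
    have "P0 P d * m x \<le> P x y * (d x y)\<^sup>2 * m x"
      by (intro mult_right_mono P0_le y m_nonneg)
    also have "\<dots> = p x y * (max 0 (g y - g x))\<^sup>2"
      using y(2) d_nonneg[of x y] by (simp add: p_def max_def)
    also have "\<dots> \<le> (\<Sum>y\<in>UNIV. p x y * (max 0 (g y - g x))\<^sup>2)"
      by (rule member_le_sum) (auto simp: p_nonneg)
    finally show ?thesis .
  qed
  then have S_ge: "P0 P d * M \<le> S"
    unfolding S_def M_def sum_distrib_left by (intro sum_mono)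
  \<comment> \<open>In both sign cases \<open>h x y\<close> equals
    \<open>p x y * max (g x) (g y) * (g y - g x)\<close>, which is visibly antisymmetric. This is
    the reason for adding \<open>g x * (g y - g x)\<close>, whose sum over \<open>y\<close> is a
    Laplacian term.\<close>
  define h where "h x y = p x y * ((max 0 (g y - g x))\<^sup>2 + g x * (g y - g x))" for x y
  have "h x y + h y x = 0" for x y
    using p_sym[of x y] by (auto simp: h_def max_def power2_eq_square algebra_simps)
  note h_sum = sum_antisym[of h, OF this]
  \<comment> \<open>If \<open>P x y > 0\<close>, both ends lie in \<open>?cl\<close>, so the maximum
    in \<open>h\<close> is between 0 and \<open>D\<close>. Otherwise \<open>y\<close> may lie
    outside \<open>?cl\<close>, but the weight \<open>p x y\<close> vanishes.\<close>
  have h_le: "h x y \<le> D * (p x y * d x y)" if "x \<in> W" "y \<in> -W" for x y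
  proof (cases "P x y > 0")
    case True
    then have gs: "0 \<le> g x" "0 \<le> g y" "g y \<le> D"
      using that nbr_cl[of x y] W_cl[of x] g0 gD by auto
    have "(max 0 (g y - g x))\<^sup>2 + g x * (g y - g x) \<le> D * d x y"
    proof (cases "g x \<le> g y")
      case True
      then have "(max 0 (g y - g x))\<^sup>2 + g x * (g y - g x) = g y * (g y - g x)"
        by (simp add: power2_eq_square algebra_simps)
      also have "\<dots> \<le> D * d x y"
        using gs True g_lip by (intro mult_mono) auto
      finally show ?thesis .
    next
      case False
      then have "g x * (g y - g x) \<le> 0" using gs by (intro mult_nonneg_nonpos) auto
      moreover have "0 \<le> D * d x y" using D d_nonneg by simp
      ultimately show ?thesis using False by simp
    qed
    from mult_left_mono[OF this p_nonneg, of x y] show ?thesis by (simp add: h_def mult_ac)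
  next
    case False
    then have "p x y = 0" using P_nonneg[of x y] by (simp add: p_def)
    then show ?thesis by (simp add: h_def)
  qed
  have "S + (\<Sum>x\<in>W. g x * (m x * laplacian P g x)) = (\<Sum>x\<in>W. \<Sum>y\<in>UNIV. h x y)"
    by (simp add: S_def lap h_def sum_distrib_left algebra_simps flip: sum.distrib)
  also have "\<dots> \<le> D * B"
    unfolding h_sum B sum_distrib_left by (intro sum_mono h_le)
  finally have S_le: "S + (\<Sum>x\<in>W. g x * (m x * laplacian P g x)) \<le> D * B" .
  \<comment> \<open>\<open>E\<close> combines \<open>g x \<le> D\<close> with
    \<open>- C \<le> B / (1 - M)\<close>; it bounds the possible negative contribution of the bulk
    term per unit of mass.\<close>
  define E where "E = D * (B / (1 - M))"
  have "- E * m x \<le> g x * (m x * laplacian P g x)" if x: "x \<in> W" for x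
  proof -
    have gx: "0 \<le> g x" "g x \<le> D" using g0 gD W_cl x by auto
    have "- (B / (1 - M)) \<le> C" using C M1 by (simp add: field_simps)
    also have "\<dots> \<le> laplacian P g x" by (rule lap_W)
    finally have "g x * - (B / (1 - M)) \<le> g x * laplacian P g x" using gx by (intro mult_left_mono)
    moreover have "g x * (B / (1 - M)) \<le> D * (B / (1 - M))"
      using gx M1 boundary_measure_nonneg[of W] by (intro mult_right_mono) (auto simp: B_def)
    ultimately have "- E \<le> g x * laplacian P g x" unfolding E_def by linarith
    from mult_right_mono[OF this m_nonneg, of x] show ?thesis by (simp add: mult_ac)
  qed
  then have "- E * M \<le> (\<Sum>x\<in>W. g x * (m x * laplacian P g x))"
    unfolding M_def sum_distrib_left by (intro sum_mono)
  with S_ge S_le have "P0 P d * M \<le> D * B + E * M" by linarith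
  \<comment> \<open>Here \<open>1 + M / (1 - M) = 1 / (1 - M)\<close> merges the boundary and bulk
    terms into the factor \<open>1 - M\<close> of the claim.\<close>
  also have "\<dots> = D * B / (1 - M)" using M1 by (simp add: E_def field_simps)
  finally have "P0 P d * M * (1 - M) \<le> D * B" using M1 by (simp add: field_simps)
  then show ?thesis using D by (simp add: field_simps)
qed

end

theorem theorem6p8:
  fixes P d :: "'a::finite \<Rightarrow> 'a \<Rightarrow> real" and m :: "'a \<Rightarrow> real" and W :: "'a set"
  assumes "reversible_metric_markov_chain P d m"
    and "\<forall>x y. adj P x y \<longrightarrow> ollivier_curvature P d x y \<ge> 0"
  shows "boundary_measure P d m W \<ge>
           P0 P d / diameter d (closure_set P W) * (sum m W * (1 - sum m W))"
proof -
  interpret nonneg_curved_chain P d m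
    using assms by unfold_locales auto
  show ?thesis by (rule isoperimetry)
qed

end
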